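(* Let $\lambda$ be a regular cardinal and let $\mathcal A$ be a $\lambda$-mono-generated category. Suppose $X$ is a $\lambda$-generated object of $\mathcal A$, $Y$ is an object of $\mathcal A$, and $X\sim_\lambda Y$. Then $X$ and $Y$ are isomorphic.
   Context: Regular cardinals are infinite. A $\lambda$-directed diagram is a functor whose domain is a $\lambda$-directed poset (every subset of cardinality $<\lambda$ has an upper bound); a $\lambda$-directed colimit of monomorphisms is a colimit of a $\lambda$-directed diagram all of whose maps are monomorphisms. An object $G$ of a category $\mathcal A$ is $\lambda$-generated if $\hom(G,-):\mathcal A\to \mathrm{Set}$ preserves those $\lambda$-directed colimits of monomorphisms that exist in $\mathcal A$. The category $\mathcal A$ is $\lambda$-mono-generated if every object of $\mathcal A$ is a colimit of a $\lambda$-directed diagram consisting of monomorphisms and $\lambda$-generated objects. (It is not assumed that all $\lambda$-directed colimits of monomorphisms exist.) A span between objects $X,Y$ is a diagram $X\xleftarrow{x}U\xrightarrow{y}Y$ with both $x,y$ monomorphisms. A set $\{X\xleftarrow{x_i}U_i\xrightarrow{y_i}Y \mid i\in I\}$ of spans is $\lambda$-dense if it is non-empty and: (back) for all $i\in I$ and every monomorphism $g:G\to X$ with $G$ $\lambda$-generated, there exist $j\in I$ and morphisms $s:G\to U_j$, $w:U_i\to U_j$ with $x_js=g$, $x_jw=x_i$, $y_jw=y_i$; (forth) for all $i\in I$ and every monomorphism $g:G\to Y$ with $G$ $\lambda$-generated, there exist $j\in I$ and morphisms $s:G\to U_j$, $w:U_i\to U_j$ with $y_js=g$, $x_jw=x_i$,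 $y_jw=y_i$. Objects $X,Y$ are $\lambda$-equivalent, written $X\sim_\lambda Y$, if there exists a $\lambda$-dense set of spans between $X$ and $Y$. *)

theory Defs
  imports Main "HOL-Library.FuncSet"
begin

unbundle cardinal_syntax

section \<open>Categories, functors, colimits\<close>

record ('o, 'm) category =
  Obj :: "'o set"
  Mor :: "'m set"
  Dom :: "'m \<Rightarrow> 'o"
  Cod :: "'m \<Rightarrow> 'o"
  Id :: "'o \<Rightarrow> 'm"
  Comp :: "'m \<Rightarrow> 'm \<Rightarrow> 'm"  (infixr "\<cdot>\<index>" 75)

definition hom :: "('o, 'm) category \<Rightarrow> 'o \<Rightarrow> 'o \<Rightarrow> 'm set" where
  "hom C a b = {f \<in> Mor C. Dom C f = a \<and> Cod C f = b}"

locale category =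
  fixes C :: "('o, 'm) category" (structure)
  assumes Dom_Obj: "f \<in> Mor C \<Longrightarrow> Dom C f \<in> Obj C"
    and Cod_Obj: "f \<in> Mor C \<Longrightarrow> Cod C f \<in> Obj C"
    and Id_hom: "a \<in> Obj C \<Longrightarrow> Id C a \<in> hom C a a"
    and Comp_hom: "f \<in> hom C a b \<Longrightarrow> g \<in> hom C b c \<Longrightarrow> g \<cdot> f \<in> hom C a c"
    and Comp_Id: "f \<in> hom C a b \<Longrightarrow> f \<cdot> Id C a = f"
    and Id_Comp: "f \<in> hom C a b \<Longrightarrow> Id C b \<cdot> f = f"
    and Comp_assoc: "f \<in> hom C a b \<Longrightarrow> g \<in> hom C b c \<Longrightarrow> h \<in> hom C c d \<Longrightarrow>
                       (h \<cdot> g) \<cdot> f = h \<cdot> (g \<cdot> f)"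

definition monic :: "('o, 'm) category \<Rightarrow> 'm \<Rightarrow> bool" where
  "monic C f \<longleftrightarrow> f \<in> Mor C \<and>
     (\<forall>a. \<forall>g \<in> hom C a (Dom C f). \<forall>h \<in> hom C a (Dom C f). f \<cdot>\<^bsub>C\<^esub> g = f \<cdot>\<^bsub>C\<^esub> h \<longrightarrow> g = h)"

definition isomorphic :: "('o, 'm) category \<Rightarrow> 'o \<Rightarrow> 'o \<Rightarrow> bool" where
  "isomorphic C a b \<longleftrightarrow> a \<in> Obj C \<and> b \<in> Obj C \<and>
     (\<exists>f \<in> hom C a b. \<exists>g \<in> hom C b a. g \<cdot>\<^bsub>C\<^esub> f = Id C a \<and> f \<cdot>\<^bsub>C\<^esub> g = Id C b)"

record ('o1, 'm1, 'o2, 'm2) "functor" =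
  onObj :: "'o1 \<Rightarrow> 'o2"
  onMor :: "'m1 \<Rightarrow> 'm2"

definition is_functor ::
  "('o1, 'm1) category \<Rightarrow> ('o2, 'm2) category \<Rightarrow> ('o1, 'm1, 'o2, 'm2) functor \<Rightarrow> bool" where
  "is_functor C D F \<longleftrightarrow> category C \<and> category D \<and>
     (\<forall>a \<in> Obj C. onObj F a \<in> Obj D) \<and>
     (\<forall>f \<in> Mor C. onMor F f \<in> hom D (onObj F (Dom C f)) (onObj F (Cod C f))) \<and>
     (\<forall>a \<in> Obj C. onMor F (Id C a) = Id D (onObj F a)) \<and>
     (\<forall>a b c. \<forall>f \<in> hom C a b. \<forall>g \<in> hom C b c. onMor F (g \<cdot>\<^bsub>C\<^esub> f) = onMor F g \<cdot>\<^bsub>D\<^esub> onMor F f)"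

definition functor_comp ::
  "('o2, 'm2, 'o3, 'm3) functor \<Rightarrow> ('o1, 'm1, 'o2, 'm2) functor \<Rightarrow> ('o1, 'm1, 'o3, 'm3) functor" where
  "functor_comp G F = \<lparr>onObj = onObj G \<circ> onObj F, onMor = onMor G \<circ> onMor F\<rparr>"

definition cocone ::
  "('j, 'k) category \<Rightarrow> ('o, 'm) category \<Rightarrow> ('j, 'k, 'o, 'm) functor \<Rightarrow> 'o \<Rightarrow> ('j \<Rightarrow> 'm) \<Rightarrow> bool" where
  "cocone J C D L c \<longleftrightarrow> L \<in> Obj C \<and>
     (\<forall>i \<in> Obj J. c i \<in> hom C (onObj D i) L) \<and>
     (\<forall>u \<in> Mor J. c (Cod J u) \<cdot>\<^bsub>C\<^esub> onMor D u = c (Dom J u))"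

definition colimit ::
  "('j, 'k) category \<Rightarrow> ('o, 'm) category \<Rightarrow> ('j, 'k, 'o, 'm) functor \<Rightarrow> 'o \<Rightarrow> ('j \<Rightarrow> 'm) \<Rightarrow> bool" where
  "colimit J C D L c \<longleftrightarrow> is_functor J C D \<and> cocone J C D L c \<and>
     (\<forall>L' c'. cocone J C D L' c' \<longrightarrow>
        (\<exists>!h. h \<in> hom C L L' \<and> (\<forall>i \<in> Obj J. h \<cdot>\<^bsub>C\<^esub> c i = c' i)))"

section \<open>The hom functor into sets\<close>

text \<open>
  The category of all sets with elements of type \<open>'e\<close>.  A morphism is a function together with its
  domain and codomain; functions are extensional, so that they are equal iff they agree on the
  domain.
\<close>

definition set_category :: "('e set, 'e set \<times> ('e \<Rightarrow> 'e) \<times> 'e set) category" where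
  "set_category =
     \<lparr>Obj = UNIV,
      Mor = {(A, f, B). f \<in> A \<rightarrow>\<^sub>E B},
      Dom = (\<lambda>(A, f, B). A),
      Cod = (\<lambda>(A, f, B). B),
      Id = (\<lambda>A. (A, restrict (\<lambda>x. x) A, A)),
      Comp = (\<lambda>(B', g, E) (A, f, B). (A, compose A g f, E))\<rparr>"

text \<open>
  The hom-sets of a category with morphisms of type \<open>'m\<close> are objects of the category of sets with
  elements of type \<open>'m\<close>.  Colimits of diagrams of hom-sets have the same meaning there as among
  all sets: a cocone of sets is a colimit cocone as soon as its universal property holds for one
  target set with two elements (as maps into it determine subsets), and if \<open>'m\<close> has only one
  element then the category has at most one morphism, so that on directed diagrams the notions
  also agree.
\<close>

definition hom_functor ::
  "('o, 'm) category \<Rightarrow> 'o \<Rightarrow> ('o, 'm, 'm set, 'm set \<times> ('m \<Rightarrow> 'm) \<times> 'm set) functor" where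
  "hom_functor C G =
     \<lparr>onObj = (\<lambda>a. hom C G a),
      onMor = (\<lambda>f. (hom C G (Dom C f),
                    restrict (\<lambda>g. f \<cdot>\<^bsub>C\<^esub> g) (hom C G (Dom C f)),
                    hom C G (Cod C f)))\<rparr>"

section \<open>Directed diagrams of monomorphisms\<close>

text \<open>
  The type \<open>'u\<close> fixes the meaning of ``set'' as opposed to ``proper class'': a collection is small
  iff its cardinality is strictly below that of \<open>'u\<close>.  If the cardinality of \<open>'u\<close> is inaccessible,
  these are, up to bijection, the sets of a Grothendieck universe.  Since a small collection
  injects into \<open>'u\<close>, every small poset is isomorphic to one carried by a subset of \<open>'u\<close>.
  Categories need not be small.
\<close>

definition small :: "'u itself \<Rightarrow> 'a set \<Rightarrow> bool" where
  "small U A \<longleftrightarrow> |A| <o |UNIV :: 'u set|"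

definition regular_cardinal :: "'l rel \<Rightarrow> bool" where
  "regular_cardinal \<kappa> \<longleftrightarrow> Cinfinite \<kappa> \<and> regularCard \<kappa>"

text \<open>A poset is represented by its order relation \<open>r\<close>, whose carrier is \<open>Field r\<close>.\<close>

definition directed_poset :: "'l rel \<Rightarrow> 'u rel \<Rightarrow> bool" where
  "directed_poset \<kappa> r \<longleftrightarrow> Partial_order r \<and>
     (\<forall>A. A \<subseteq> Field r \<and> |A| <o \<kappa> \<longrightarrow> (\<exists>b \<in> Field r. \<forall>a \<in> A. (a, b) \<in> r))"

definition poset_category :: "'u rel \<Rightarrow> ('u, 'u \<times> 'u) category" where
  "poset_category r =
     \<lparr>Obj = Field r, Mor = r, Dom = fst, Cod = snd,
      Id = (\<lambda>i. (i, i)), Comp = (\<lambda>v u. (fst u, snd v))\<rparr>"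

definition directed_mono_diagram ::
  "('o, 'm) category \<Rightarrow> 'l rel \<Rightarrow> 'u rel \<Rightarrow> ('u, 'u \<times> 'u, 'o, 'm) functor \<Rightarrow> bool" where
  "directed_mono_diagram C \<kappa> r D \<longleftrightarrow>
     small TYPE('u) (Field r) \<and> directed_poset \<kappa> r \<and>
     is_functor (poset_category r) C D \<and> (\<forall>u \<in> r. monic C (onMor D u))"

definition generated :: "'u itself \<Rightarrow> ('o, 'm) category \<Rightarrow> 'l rel \<Rightarrow> 'o \<Rightarrow> bool" where
  "generated U C \<kappa> G \<longleftrightarrow> G \<in> Obj C \<and>
     (\<forall>(r :: 'u rel) D L c.
        directed_mono_diagram C \<kappa> r D \<and> colimit (poset_category r) C D L c \<longrightarrow>
        colimit (poset_category r) set_category (functor_comp (hom_functor C G) D)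
          (onObj (hom_functor C G) L) (\<lambda>i. onMor (hom_functor C G) (c i)))"

definition mono_generated :: "'u itself \<Rightarrow> ('o, 'm) category \<Rightarrow> 'l rel \<Rightarrow> bool" where
  "mono_generated U C \<kappa> \<longleftrightarrow> category C \<and>
     (\<forall>X \<in> Obj C. \<exists>(r :: 'u rel) D c.
        directed_mono_diagram C \<kappa> r D \<and> (\<forall>i \<in> Field r. generated U C \<kappa> (onObj D i)) \<and>
        colimit (poset_category r) C D X c)"

section \<open>Spans and equivalence\<close>

text \<open>A span is the pair of its legs; its apex is their common domain.\<close>

definition span :: "('o, 'm) category \<Rightarrow> 'o \<Rightarrow> 'o \<Rightarrow> 'm \<times> 'm \<Rightarrow> bool" where
  "span C X Y = (\<lambda>(x, y).
     monic C x \<and> monic C y \<and> Dom C x = Dom C y \<and> Cod C x = X \<and> Cod C y = Y)"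

definition dense_spans ::
  "'u itself \<Rightarrow> ('o, 'm) category \<Rightarrow> 'l rel \<Rightarrow> 'o \<Rightarrow> 'o \<Rightarrow> ('m \<times> 'm) set \<Rightarrow> bool" where
  "dense_spans U C \<kappa> X Y S \<longleftrightarrow>
     small U S \<and> S \<noteq> {} \<and> (\<forall>p \<in> S. span C X Y p) \<and>
     (\<forall>(x, y) \<in> S. \<forall>G g. generated U C \<kappa> G \<and> monic C g \<and> g \<in> hom C G X \<longrightarrow>
        (\<exists>(x', y') \<in> S. \<exists>s \<in> hom C G (Dom C x'). \<exists>w \<in> hom C (Dom C x) (Dom C x').
           x' \<cdot>\<^bsub>C\<^esub> s = g \<and> x' \<cdot>\<^bsub>C\<^esub> w = x \<and> y' \<cdot>\<^bsub>C\<^esub> w = y)) \<and>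
     (\<forall>(x, y) \<in> S. \<forall>G g. generated U C \<kappa> G \<and> monic C g \<and> g \<in> hom C G Y \<longrightarrow>
        (\<exists>(x', y') \<in> S. \<exists>s \<in> hom C G (Dom C x'). \<exists>w \<in> hom C (Dom C x) (Dom C x').
           y' \<cdot>\<^bsub>C\<^esub> s = g \<and> x' \<cdot>\<^bsub>C\<^esub> w = x \<and> y' \<cdot>\<^bsub>C\<^esub> w = y))"

definition equivalent_objects ::
  "'u itself \<Rightarrow> ('o, 'm) category \<Rightarrow> 'l rel \<Rightarrow> 'o \<Rightarrow> 'o \<Rightarrow> bool" where
  "equivalent_objects U C \<kappa> X Y \<longleftrightarrow> X \<in> Obj C \<and> Y \<in> Obj C \<and> (\<exists>S. dense_spans U C \<kappa> X Y S)"

end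

theory Submission
  imports Defs
begin

text \<open>
  Applying the back property to the identity of the \<open>\<lambda>\<close>-generated object \<open>X\<close> produces a span in
  the dense set whose left leg is a split epimorphism; being monic, that leg is invertible, so the
  span amounts to a single monomorphism \<open>m: X \<rightarrow> Y\<close>.  Every span that extends it again has an
  invertible left leg, and hence carries no more information than \<open>m\<close>.  The forth property
  therefore says that every monomorphism from a \<open>\<lambda>\<close>-generated object to \<open>Y\<close> factors through \<open>m\<close>
  (\<open>monos_factor_through_generated_object\<close>).

  Now present \<open>Y\<close> as a \<open>\<lambda>\<close>-directed colimit of monomorphisms between \<open>\<lambda>\<close>-generated objects.  The
  colimit injections are monic (\<open>colimit_injection_monic\<close>), so each of them factors through \<open>m\<close>.
  As \<open>m\<close> is monic, the factors form a cocone, which induces a right inverse of \<open>m\<close>; so \<open>m\<close> is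
  an isomorphism (\<open>monic_iso_if_colimit_factors\<close>).

  Monicity of the injections is not automatic in an arbitrary category.  Here it holds because the
  morphisms out of \<open>\<lambda>\<close>-generated objects are jointly able to detect equality, and for such
  morphisms the question is one about directed colimits of injective maps of sets.
\<close>

section \<open>Directed colimits of injections in the category of sets\<close>

lemma directed_pair_upper_bound:
  assumes "Cinfinite \<kappa>" and "directed_poset \<kappa> r" and "i \<in> Field r" and "j \<in> Field r"
  obtains k where "k \<in> Field r" and "(i, k) \<in> r" and "(j, k) \<in> r"
proof -
  have "|{i, j}| <o \<kappa>"
    using assms(1)
    by (intro Cfinite_ordLess_Cinfinite)
      (auto simp: cfinite_def card_of_card_order_on Field_card_of)
  then show thesis
    using assms(2-4) that unfolding directed_poset_def by (metis empty_subsetI insert_subset insertCI)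
qed

lemma set_category_hom_iff:
  "t \<in> hom set_category A B \<longleftrightarrow> (\<exists>f \<in> A \<rightarrow>\<^sub>E B. t = (A, f, B))"
  by (auto simp: hom_def set_category_def)

lemma set_category_Comp:
  "(B', g, E) \<cdot>\<^bsub>set_category\<^esub> (A, f, B) = (A, compose A g f, E)"
  by (simp add: set_category_def)

lemma poset_category_simps [simp]:
  "Obj (poset_category r) = Field r" "Mor (poset_category r) = r"
  "Dom (poset_category r) = fst" "Cod (poset_category r) = snd"
  "Id (poset_category r) i = (i, i)" "v \<cdot>\<^bsub>poset_category r\<^esub> u = (fst u, snd v)"
  by (simp_all add: poset_category_def)

text \<open>
  Two distinct elements \<open>a, b\<close> at stage \<open>i\<close> are separated by the cocone with target \<open>{a, b}\<close> that
  sends an element to \<open>a\<close> precisely if it becomes equal to \<open>a\<close> at some later stage.  The element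
  \<open>b\<close> never does, since the transition maps are injective.  Because the cocone factors through the
  colimit, \<open>a\<close> and \<open>b\<close> have different images there.
\<close>

lemma directed_colimit_injection_inj:
  fixes F :: "('u, 'u \<times> 'u, 'e set, 'e set \<times> ('e \<Rightarrow> 'e) \<times> 'e set) functor"
  assumes inf: "Cinfinite \<kappa>" and dir: "directed_poset \<kappa> r"
    and colim: "colimit (poset_category r) set_category F L c"
    and F: "\<And>j k. (j, k) \<in> r \<Longrightarrow> onMor F (j, k) = (onObj F j, f j k, onObj F k)"
    and inj: "\<And>j k. (j, k) \<in> r \<Longrightarrow> inj_on (f j k) (onObj F j)"
    and i: "i \<in> Field r" and c: "c i = (onObj F i, p, L)"
  shows "inj_on p (onObj F i)"
proof (rule inj_onI, rule ccontr)
  fix a b assume a: "a \<in> onObj F i" and b: "b \<in> onObj F i" and eq: "p a = p b" and "a \<noteq> b"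
  have tr: "(j, l) \<in> r" if "(j, k) \<in> r" "(k, l) \<in> r" for j k l
    using dir that unfolding directed_poset_def partial_order_on_def preorder_on_def
    by (meson transD)
  have rf: "(j, j) \<in> r" if "j \<in> Field r" for j
    using dir that unfolding directed_poset_def partial_order_on_def preorder_on_def
    by (meson refl_onD)
  have fld: "j \<in> Field r" "k \<in> Field r" if "(j, k) \<in> r" for j k
    using that by (auto simp: Field_def)
  have fn: "is_functor (poset_category r) set_category F"
    using colim by (simp add: colimit_def)
  have ext: "f j k \<in> onObj F j \<rightarrow>\<^sub>E onObj F k" if "(j, k) \<in> r" for j k
  proof -
    have "onMor F (j, k) \<in> hom set_category (onObj F j) (onObj F k)"
      using fn that by (fastforce simp: is_functor_def)
    then show ?thesis
      using F[OF that] by (auto simp: set_category_hom_iff)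
  qed
  have ff: "f k l (f j k x) = f j l x"
    if "(j, k) \<in> r" "(k, l) \<in> r" and x: "x \<in> onObj F j" for j k l x
  proof -
    have "(j, k) \<in> hom (poset_category r) j k" "(k, l) \<in> hom (poset_category r) k l"
      using that by (auto simp: hom_def)
    then have "onMor F ((k, l) \<cdot>\<^bsub>poset_category r\<^esub> (j, k))
        = onMor F (k, l) \<cdot>\<^bsub>set_category\<^esub> onMor F (j, k)"
      using fn unfolding is_functor_def by blast
    then have "f j l = compose (onObj F j) (f k l) (f j k)"
      using F that tr by (simp add: set_category_Comp)
    then show ?thesis
      using x by (simp add: compose_def)
  qed
  define Q where "Q j x \<longleftrightarrow> (\<exists>k. (i, k) \<in> r \<and> (j, k) \<in> r \<and> f i k a = f j k x)" for j x
  have Q_step: "Q k (f j k x) \<longleftrightarrow> Q j x" if jk: "(j, k) \<in> r" and x: "x \<in> onObj F j" for j k x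
  proof
    assume "Q k (f j k x)"
    then show "Q j x"
      unfolding Q_def using ff[OF jk _ x] tr[OF jk] by metis
  next
    assume "Q j x"
    then obtain l where l: "(i, l) \<in> r" "(j, l) \<in> r" "f i l a = f j l x"
      unfolding Q_def by blast
    obtain n where n: "(l, n) \<in> r" "(k, n) \<in> r"
      using directed_pair_upper_bound[OF inf dir] l(1) jk fld by metis
    have "f i n a = f l n (f i l a)"
      using ff[OF l(1) n(1) a] by simp
    also have "\<dots> = f j n x"
      using ff[OF l(2) n(1) x] l(3) by simp
    also have "\<dots> = f k n (f j k x)"
      using ff[OF jk n(2) x] by simp
    finally show "Q k (f j k x)"
      unfolding Q_def using tr[OF l(1) n(1)] n(2) by blast
  qed
  define q where "q j = restrict (\<lambda>x. if Q j x then a else b) (onObj F j)" for j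
  have "cocone (poset_category r) set_category F {a, b} (\<lambda>j. (onObj F j, q j, {a, b}))"
    unfolding cocone_def
  proof (intro conjI ballI)
    show "{a, b} \<in> Obj set_category"
      by (simp add: set_category_def)
  next
    fix j assume "j \<in> Obj (poset_category r)"
    show "(onObj F j, q j, {a, b}) \<in> hom set_category (onObj F j) {a, b}"
      by (auto simp: set_category_hom_iff q_def)
  next
    fix u assume "u \<in> Mor (poset_category r)"
    then obtain j k where u: "u = (j, k)" and jk: "(j, k) \<in> r"
      by (cases u) auto
    have "compose (onObj F j) (q k) (f j k) = q j"
      using ext[OF jk] Q_step[OF jk] by (auto simp: compose_def q_def fun_eq_iff restrict_def)
    then show "(onObj F (Cod (poset_category r) u), q (Cod (poset_category r) u), {a, b})
        \<cdot>\<^bsub>set_category\<^esub> onMor F u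
        = (onObj F (Dom (poset_category r) u), q (Dom (poset_category r) u), {a, b})"
      using F[OF jk] by (simp add: u set_category_Comp)
  qed
  then obtain h where h: "h \<in> hom set_category L {a, b}"
    and hc: "\<forall>j \<in> Obj (poset_category r). h \<cdot>\<^bsub>set_category\<^esub> c j = (onObj F j, q j, {a, b})"
    using colim unfolding colimit_def by meson
  from h obtain g where "h = (L, g, {a, b})"
    by (auto simp: set_category_hom_iff)
  moreover have "h \<cdot>\<^bsub>set_category\<^esub> c i = (onObj F i, q i, {a, b})"
    using hc i by simp
  ultimately have "compose (onObj F i) g p = q i"
    by (simp add: c set_category_Comp)
  then have "q i a = q i b"
    using a b eq by (metis compose_eq)
  moreover have "Q i a"
    unfolding Q_def using rf[OF i] by blast
  moreover have "\<not> Q i b"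
    unfolding Q_def using inj a b \<open>a \<noteq> b\<close> by (auto dest: inj_onD)
  ultimately show False
    using a b \<open>a \<noteq> b\<close> by (simp add: q_def)
qed

section \<open>Colimits in mono-generated categories\<close>

lemma monicI:
  assumes "f \<in> hom C a b"
    and "\<And>z g h. g \<in> hom C z a \<Longrightarrow> h \<in> hom C z a \<Longrightarrow> f \<cdot>\<^bsub>C\<^esub> g = f \<cdot>\<^bsub>C\<^esub> h \<Longrightarrow> g = h"
  shows "monic C f"
proof -
  have "f \<in> Mor C" and "Dom C f = a"
    using assms(1) by (simp_all add: hom_def)
  then show ?thesis
    using assms(2) by (simp add: monic_def)
qed

lemma monicD:
  assumes "monic C f" and "f \<in> hom C a b" and "g \<in> hom C z a" and "h \<in> hom C z a"
    and "f \<cdot>\<^bsub>C\<^esub> g = f \<cdot>\<^bsub>C\<^esub> h"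
  shows "g = h"
  using assms unfolding monic_def hom_def by blast

lemma hom_ObjD:
  assumes "category C" and "f \<in> hom C a b"
  shows "a \<in> Obj C" and "b \<in> Obj C"
  using assms category.Dom_Obj category.Cod_Obj unfolding hom_def by fastforce+

lemma colimit_injection_hom:
  assumes "colimit J C D L c" and "i \<in> Obj J"
  shows "c i \<in> hom C (onObj D i) L"
  using assms unfolding colimit_def cocone_def by blast

lemma colimit_jointly_epic:
  assumes "category C" and "colimit J C D L c" and "u \<in> hom C L Z" and "v \<in> hom C L Z"
    and eq: "\<And>i. i \<in> Obj J \<Longrightarrow> u \<cdot>\<^bsub>C\<^esub> c i = v \<cdot>\<^bsub>C\<^esub> c i"
  shows "u = v"
proof -
  interpret category C by fact
  have D: "is_functor J C D" and c: "cocone J C D L c"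
    using assms(2) by (auto simp: colimit_def)
  have "cocone J C D Z (\<lambda>i. u \<cdot>\<^bsub>C\<^esub> c i)"
    unfolding cocone_def
  proof (intro conjI ballI)
    show "Z \<in> Obj C"
      using hom_ObjD[OF assms(1,3)] by blast
  next
    fix i assume "i \<in> Obj J"
    then show "u \<cdot>\<^bsub>C\<^esub> c i \<in> hom C (onObj D i) Z"
      using colimit_injection_hom[OF assms(2)] assms(3) Comp_hom by blast
  next
    fix t assume t: "t \<in> Mor J"
    then have "c (Cod J t) \<in> hom C (onObj D (Cod J t)) L"
        and "onMor D t \<in> hom C (onObj D (Dom J t)) (onObj D (Cod J t))"
      using D colimit_injection_hom[OF assms(2)] unfolding is_functor_def
      by (auto dest: category.Cod_Obj)
    then show "(u \<cdot>\<^bsub>C\<^esub> c (Cod J t)) \<cdot>\<^bsub>C\<^esub> onMor D t = u \<cdot>\<^bsub>C\<^esub> c (Dom J t)"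
      using Comp_assoc[OF _ _ assms(3)] c t unfolding cocone_def by metis
  qed
  then have "\<exists>!h. h \<in> hom C L Z \<and> (\<forall>i \<in> Obj J. h \<cdot>\<^bsub>C\<^esub> c i = u \<cdot>\<^bsub>C\<^esub> c i)"
    using assms(2) unfolding colimit_def by blast
  then show ?thesis
    using assms(3,4) eq by metis
qed

text \<open>
  The functor represented by a generated object turns the given colimit into a directed colimit of
  injective maps of sets, where the injections are injective.
\<close>

lemma colimit_injection_monic_on_generated:
  fixes C :: "('o, 'm) category" and r :: "'u rel"
  assumes "category C" and inf: "Cinfinite \<kappa>"
    and diag: "directed_mono_diagram C \<kappa> r D" and colim: "colimit (poset_category r) C D L c"
    and gen: "generated TYPE('u) C \<kappa> G" and i: "i \<in> Field r"
    and g: "g \<in> hom C G (onObj D i)" and h: "h \<in> hom C G (onObj D i)"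
    and eq: "c i \<cdot>\<^bsub>C\<^esub> g = c i \<cdot>\<^bsub>C\<^esub> h"
  shows "g = h"
proof -
  interpret category C by fact
  have Dm: "onMor D (j, k) \<in> hom C (onObj D j) (onObj D k)" if "(j, k) \<in> r" for j k
    using diag that unfolding directed_mono_diagram_def is_functor_def by fastforce
  have ci: "c i \<in> hom C (onObj D i) L"
    using colimit_injection_hom[OF colim] i by simp
  define F where "F = functor_comp (hom_functor C G) D"
  have F_obj: "onObj F j = hom C G (onObj D j)" for j
    by (simp add: F_def functor_comp_def hom_functor_def)
  have "inj_on (restrict (\<lambda>g. c i \<cdot>\<^bsub>C\<^esub> g) (hom C G (onObj D i))) (onObj F i)"
  proof (rule directed_colimit_injection_inj[OF inf])
    show "directed_poset \<kappa> r"
      using diag by (simp add: directed_mono_diagram_def)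
    show "colimit (poset_category r) set_category F
        (onObj (hom_functor C G) L) (\<lambda>i. onMor (hom_functor C G) (c i))"
      using gen diag colim unfolding generated_def F_def by blast
    show "i \<in> Field r"
      by fact
    show "onMor (hom_functor C G) (c i) =
        (onObj F i, restrict (\<lambda>g. c i \<cdot>\<^bsub>C\<^esub> g) (hom C G (onObj D i)), onObj (hom_functor C G) L)"
      using ci unfolding F_obj by (auto simp: hom_functor_def hom_def)
    show "onMor F (j, k) = (onObj F j,
        restrict (\<lambda>g. onMor D (j, k) \<cdot>\<^bsub>C\<^esub> g) (hom C G (onObj D j)), onObj F k)"
      if "(j, k) \<in> r" for j k
      using Dm[OF that] unfolding F_obj
      by (auto simp: F_def functor_comp_def hom_functor_def hom_def)
    show "inj_on (restrict (\<lambda>g. onMor D (j, k) \<cdot>\<^bsub>C\<^esub> g) (hom C G (onObj D j))) (onObj F j)"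
      if "(j, k) \<in> r" for j k
    proof (rule inj_onI)
      have m: "monic C (onMor D (j, k))"
        using diag that by (auto simp: directed_mono_diagram_def)
      fix a b assume "a \<in> onObj F j" "b \<in> onObj F j"
        and "restrict (\<lambda>g. onMor D (j, k) \<cdot>\<^bsub>C\<^esub> g) (hom C G (onObj D j)) a =
          restrict (\<lambda>g. onMor D (j, k) \<cdot>\<^bsub>C\<^esub> g) (hom C G (onObj D j)) b"
      then show "a = b"
        using monicD[OF m Dm[OF that]] by (simp add: F_obj)
    qed
  qed
  then show ?thesis
    using g h eq by (auto simp: F_obj dest: inj_onD)
qed

text \<open>
  Every object is covered by generated ones: two morphisms with domain \<open>Z\<close> agree if they agree
  on the generated objects of which \<open>Z\<close> is a colimit, so it suffices to cancel a colimit injection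
  against morphisms out of generated objects.
\<close>

lemma colimit_injection_monic:
  fixes C :: "('o, 'm) category" and r :: "'u rel"
  assumes mg: "mono_generated TYPE('u) C \<kappa>" and inf: "Cinfinite \<kappa>"
    and diag: "directed_mono_diagram C \<kappa> r D" and colim: "colimit (poset_category r) C D L c"
    and i: "i \<in> Field r"
  shows "monic C (c i)"
proof -
  have cat: "category C"
    using mg by (simp add: mono_generated_def)
  then interpret category C .
  have ci: "c i \<in> hom C (onObj D i) L"
    using colimit_injection_hom[OF colim] i by simp
  have "u = v" if u: "u \<in> hom C Z (onObj D i)" and v: "v \<in> hom C Z (onObj D i)"
    and eq: "c i \<cdot>\<^bsub>C\<^esub> u = c i \<cdot>\<^bsub>C\<^esub> v" for Z u v
  proof -
    have "Z \<in> Obj C"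
      using hom_ObjD[OF cat u] by blast
    then obtain s :: "'u rel" and E d where
      gen: "\<forall>j \<in> Field s. generated TYPE('u) C \<kappa> (onObj E j)"
      and colim_Z: "colimit (poset_category s) C E Z d"
      using mg unfolding mono_generated_def by blast
    show ?thesis
    proof (rule colimit_jointly_epic[OF cat colim_Z u v])
      fix j assume "j \<in> Obj (poset_category s)"
      then have j: "j \<in> Field s"
        by simp
      have dj: "d j \<in> hom C (onObj E j) Z"
        using colimit_injection_hom[OF colim_Z] j by simp
      have "c i \<cdot>\<^bsub>C\<^esub> (u \<cdot>\<^bsub>C\<^esub> d j) = c i \<cdot>\<^bsub>C\<^esub> (v \<cdot>\<^bsub>C\<^esub> d j)"
        using Comp_assoc[OF dj u ci] Comp_assoc[OF dj v ci] eq by simp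
      then show "u \<cdot>\<^bsub>C\<^esub> d j = v \<cdot>\<^bsub>C\<^esub> d j"
        using colimit_injection_monic_on_generated[OF cat inf diag colim _ i
            Comp_hom[OF dj u] Comp_hom[OF dj v]] gen j by blast
    qed
  qed
  then show ?thesis
    by (rule monicI[OF ci])
qed

text \<open>
  The factors of the injections through \<open>m\<close> form a cocone as \<open>m\<close> is monic; the induced morphism is
  a right inverse of \<open>m\<close>, and a right inverse of a monomorphism is also a left inverse.
\<close>

lemma monic_iso_if_colimit_factors:
  assumes "category C" and colim: "colimit J C D Y c"
    and mono: "monic C m" and m: "m \<in> hom C X Y"
    and factor: "\<And>i. i \<in> Obj J \<Longrightarrow> \<exists>t \<in> hom C (onObj D i) X. m \<cdot>\<^bsub>C\<^esub> t = c i"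
  shows "isomorphic C X Y"
proof -
  interpret category C by fact
  have X: "X \<in> Obj C" and Y: "Y \<in> Obj C"
    using hom_ObjD[OF assms(1) m] by auto
  have D: "is_functor J C D"
    using colim by (simp add: colimit_def)
  obtain t where t: "\<And>i. i \<in> Obj J \<Longrightarrow> t i \<in> hom C (onObj D i) X"
    and mt: "\<And>i. i \<in> Obj J \<Longrightarrow> m \<cdot>\<^bsub>C\<^esub> t i = c i"
    using factor by metis
  have "cocone J C D X t"
    unfolding cocone_def
  proof (intro conjI ballI)
    show "X \<in> Obj C" by fact
  next
    fix i assume "i \<in> Obj J"
    then show "t i \<in> hom C (onObj D i) X" by (rule t)
  next
    fix u assume u: "u \<in> Mor J"
    have dom: "Dom J u \<in> Obj J" and cod: "Cod J u \<in> Obj J"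
      using D u unfolding is_functor_def by (auto dest: category.Dom_Obj category.Cod_Obj)
    have Du: "onMor D u \<in> hom C (onObj D (Dom J u)) (onObj D (Cod J u))"
      using D u unfolding is_functor_def by blast
    have "m \<cdot>\<^bsub>C\<^esub> (t (Cod J u) \<cdot>\<^bsub>C\<^esub> onMor D u) = c (Cod J u) \<cdot>\<^bsub>C\<^esub> onMor D u"
      using Comp_assoc[OF Du t[OF cod] m] mt[OF cod] by simp
    also have "\<dots> = m \<cdot>\<^bsub>C\<^esub> t (Dom J u)"
      using colim u mt[OF dom] by (simp add: colimit_def cocone_def)
    finally show "t (Cod J u) \<cdot>\<^bsub>C\<^esub> onMor D u = t (Dom J u)"
      by (rule monicD[OF mono m Comp_hom[OF Du t[OF cod]] t[OF dom]])
  qed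
  then obtain h where h: "h \<in> hom C Y X" and hc: "\<forall>i \<in> Obj J. h \<cdot>\<^bsub>C\<^esub> c i = t i"
    using colim unfolding colimit_def by meson
  have mh: "m \<cdot>\<^bsub>C\<^esub> h = Id C Y"
  proof (rule colimit_jointly_epic[OF assms(1) colim Comp_hom[OF h m] Id_hom[OF Y]])
    fix i assume i: "i \<in> Obj J"
    note ci = colimit_injection_hom[OF colim i]
    show "(m \<cdot>\<^bsub>C\<^esub> h) \<cdot>\<^bsub>C\<^esub> c i = Id C Y \<cdot>\<^bsub>C\<^esub> c i"
      using Comp_assoc[OF ci h m] hc mt[OF i] i Id_Comp[OF ci] by simp
  qed
  have "m \<cdot>\<^bsub>C\<^esub> (h \<cdot>\<^bsub>C\<^esub> m) = m \<cdot>\<^bsub>C\<^esub> Id C X"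
    using Comp_assoc[OF m h m] mh Id_Comp[OF m] Comp_Id[OF m] by simp
  then have "h \<cdot>\<^bsub>C\<^esub> m = Id C X"
    by (rule monicD[OF mono m Comp_hom[OF m h] Id_hom[OF X]])
  then show ?thesis
    using X Y m h mh unfolding isomorphic_def by blast
qed

section \<open>Dense sets of spans from a generated object\<close>

lemma monic_split_epi_inverse:
  assumes "category C" and "monic C x" and x: "x \<in> hom C U X" and s: "s \<in> hom C X U"
    and "x \<cdot>\<^bsub>C\<^esub> s = Id C X"
  shows "s \<cdot>\<^bsub>C\<^esub> x = Id C U"
proof -
  interpret category C by fact
  have U: "U \<in> Obj C"
    using hom_ObjD[OF assms(1) x] by blast
  have "x \<cdot>\<^bsub>C\<^esub> (s \<cdot>\<^bsub>C\<^esub> x) = x \<cdot>\<^bsub>C\<^esub> Id C U"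
    using Comp_assoc[OF x s x] assms(5) Id_Comp[OF x] Comp_Id[OF x] by simp
  then show ?thesis
    by (rule monicD[OF assms(2) x Comp_hom[OF x s] Id_hom[OF U]])
qed

lemma dense_spans_back:
  assumes "dense_spans TYPE('u) C \<kappa> X Y S" and "(x, y) \<in> S"
    and "generated TYPE('u) C \<kappa> G" and "monic C g" and "g \<in> hom C G X"
  obtains x' y' s w where "(x', y') \<in> S" and "s \<in> hom C G (Dom C x')"
    and "w \<in> hom C (Dom C x) (Dom C x')" and "x' \<cdot>\<^bsub>C\<^esub> s = g"
    and "x' \<cdot>\<^bsub>C\<^esub> w = x" and "y' \<cdot>\<^bsub>C\<^esub> w = y"
proof -
  have "\<forall>p \<in> S. \<forall>G g. generated TYPE('u) C \<kappa> G \<and> monic C g \<and> g \<in> hom C G X \<longrightarrow>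
      (\<exists>q \<in> S. \<exists>s \<in> hom C G (Dom C (fst q)). \<exists>w \<in> hom C (Dom C (fst p)) (Dom C (fst q)).
        fst q \<cdot>\<^bsub>C\<^esub> s = g \<and> fst q \<cdot>\<^bsub>C\<^esub> w = fst p \<and> snd q \<cdot>\<^bsub>C\<^esub> w = snd p)"
    using assms(1) unfolding dense_spans_def case_prod_beta by (elim conjE)
  from this[THEN bspec, OF assms(2), rule_format, OF conjI[OF assms(3) conjI[OF assms(4,5)]]]
  show thesis
    by (auto intro: that)
qed

lemma dense_spans_forth:
  assumes "dense_spans TYPE('u) C \<kappa> X Y S" and "(x, y) \<in> S"
    and "generated TYPE('u) C \<kappa> G" and "monic C g" and "g \<in> hom C G Y"
  obtains x' y' s w where "(x', y') \<in> S" and "s \<in> hom C G (Dom C x')"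
    and "w \<in> hom C (Dom C x) (Dom C x')" and "y' \<cdot>\<^bsub>C\<^esub> s = g"
    and "x' \<cdot>\<^bsub>C\<^esub> w = x" and "y' \<cdot>\<^bsub>C\<^esub> w = y"
proof -
  have "\<forall>p \<in> S. \<forall>G g. generated TYPE('u) C \<kappa> G \<and> monic C g \<and> g \<in> hom C G Y \<longrightarrow>
      (\<exists>q \<in> S. \<exists>s \<in> hom C G (Dom C (fst q)). \<exists>w \<in> hom C (Dom C (fst p)) (Dom C (fst q)).
        snd q \<cdot>\<^bsub>C\<^esub> s = g \<and> fst q \<cdot>\<^bsub>C\<^esub> w = fst p \<and> snd q \<cdot>\<^bsub>C\<^esub> w = snd p)"
    using assms(1) unfolding dense_spans_def case_prod_beta by (elim conjE)
  from this[THEN bspec, OF assms(2), rule_format, OF conjI[OF assms(3) conjI[OF assms(4,5)]]]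
  show thesis
    by (auto intro: that)
qed

text \<open>
  The back property for the identity of \<open>X\<close> yields a span \<open>(x, y)\<close> and a section \<open>s\<close> of the monic
  leg \<open>x\<close>; thus \<open>s\<close> is invertible and \<open>m = y \<cdot> s\<close> is monic.  If the forth property
  extends \<open>(x, y)\<close> along \<open>w\<close> to a span \<open>(x', y')\<close>, then \<open>w \<cdot> s\<close> is inverse to \<open>x'\<close>, so
  \<open>y' = m \<cdot> x'\<close>, and whatever factors through \<open>y'\<close> factors through \<open>m\<close>.
\<close>

lemma monos_factor_through_generated_object:
  fixes C :: "('o, 'm) category"
  assumes cat: "category C" and gen: "generated TYPE('u) C \<kappa> X"
    and dense: "dense_spans TYPE('u) C \<kappa> X Y S"
  obtains m where "m \<in> hom C X Y" and "monic C m"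
    and "\<And>G g. generated TYPE('u) C \<kappa> G \<Longrightarrow> monic C g \<Longrightarrow> g \<in> hom C G Y \<Longrightarrow>
           \<exists>t \<in> hom C G X. m \<cdot>\<^bsub>C\<^esub> t = g"
proof -
  interpret category C by (rule cat)
  have X: "X \<in> Obj C"
    using gen by (simp add: generated_def)
  note idX = Id_hom[OF X]
  have legs: "monic C x" "monic C y" "x \<in> hom C (Dom C x) X" "y \<in> hom C (Dom C x) Y"
    if "(x, y) \<in> S" for x y
    using dense that unfolding dense_spans_def span_def monic_def hom_def by auto
  have mono_id: "monic C (Id C X)"
    using Id_Comp by (intro monicI[OF idX]) metis
  obtain x0 y0 where S0: "(x0, y0) \<in> S"
    using dense unfolding dense_spans_def by (metis equals0I surj_pair)
  obtain x y s where S: "(x, y) \<in> S" and s: "s \<in> hom C X (Dom C x)"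
    and xs: "x \<cdot>\<^bsub>C\<^esub> s = Id C X"
    by (rule dense_spans_back[OF dense S0 gen mono_id idX])
  define U where "U = Dom C x"
  have xm: "monic C x" and ym: "monic C y" and x: "x \<in> hom C U X" and y: "y \<in> hom C U Y"
    and s: "s \<in> hom C X U"
    using legs[OF S] s by (auto simp: U_def)
  have ys: "y \<cdot>\<^bsub>C\<^esub> s \<in> hom C X Y"
    by (rule Comp_hom[OF s y])
  have "u = v" if u: "u \<in> hom C Z X" and v: "v \<in> hom C Z X"
    and eq: "(y \<cdot>\<^bsub>C\<^esub> s) \<cdot>\<^bsub>C\<^esub> u = (y \<cdot>\<^bsub>C\<^esub> s) \<cdot>\<^bsub>C\<^esub> v" for Z u v
  proof -
    have "s \<cdot>\<^bsub>C\<^esub> u = s \<cdot>\<^bsub>C\<^esub> v"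
      using monicD[OF ym y Comp_hom[OF u s] Comp_hom[OF v s]] eq
        Comp_assoc[OF u s y] Comp_assoc[OF v s y] by simp
    then show ?thesis
      using Comp_assoc[OF u s x] Comp_assoc[OF v s x] xs Id_Comp[OF u] Id_Comp[OF v] by simp
  qed
  then have "monic C (y \<cdot>\<^bsub>C\<^esub> s)"
    by (rule monicI[OF ys])
  moreover have "\<exists>t \<in> hom C G X. (y \<cdot>\<^bsub>C\<^esub> s) \<cdot>\<^bsub>C\<^esub> t = g"
    if g: "generated TYPE('u) C \<kappa> G" "monic C g" "g \<in> hom C G Y" for G g
  proof -
    obtain x' y' t w where S': "(x', y') \<in> S" and t: "t \<in> hom C G (Dom C x')"
      and w: "w \<in> hom C (Dom C x) (Dom C x')"
      and eqs: "y' \<cdot>\<^bsub>C\<^esub> t = g" "x' \<cdot>\<^bsub>C\<^esub> w = x" "y' \<cdot>\<^bsub>C\<^esub> w = y"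
      by (rule dense_spans_forth[OF dense S g])
    define V where "V = Dom C x'"
    have xm': "monic C x'" and x': "x' \<in> hom C V X" and y': "y' \<in> hom C V Y"
      and t: "t \<in> hom C G V" and w: "w \<in> hom C U V"
      using legs[OF S'] t w by (auto simp: U_def V_def)
    note ws = Comp_hom[OF s w]
    have "x' \<cdot>\<^bsub>C\<^esub> (w \<cdot>\<^bsub>C\<^esub> s) = Id C X"
      using Comp_assoc[OF s w x'] eqs xs by simp
    then have inv: "(w \<cdot>\<^bsub>C\<^esub> s) \<cdot>\<^bsub>C\<^esub> x' = Id C V"
      by (rule monic_split_epi_inverse[OF cat xm' x' ws])
    have "(y \<cdot>\<^bsub>C\<^esub> s) \<cdot>\<^bsub>C\<^esub> x' = (y' \<cdot>\<^bsub>C\<^esub> (w \<cdot>\<^bsub>C\<^esub> s)) \<cdot>\<^bsub>C\<^esub> x'"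
      using Comp_assoc[OF s w y'] eqs by simp
    also have "\<dots> = y'"
      using Comp_assoc[OF x' ws y'] inv Comp_Id[OF y'] by simp
    finally have "(y \<cdot>\<^bsub>C\<^esub> s) \<cdot>\<^bsub>C\<^esub> (x' \<cdot>\<^bsub>C\<^esub> t) = g"
      using Comp_assoc[OF t x' ys] eqs by simp
    then show ?thesis
      using Comp_hom[OF t x'] by blast
  qed
  ultimately show thesis
    using that ys by blast
qed

theorem proposition2p12:
  fixes C :: "('o, 'm) category"
    and \<kappa> :: "'l rel"
    and X Y :: 'o
  assumes "regular_cardinal \<kappa>"
    and "mono_generated TYPE('u) C \<kappa>"
    and "generated TYPE('u) C \<kappa> X"
    and "Y \<in> Obj C"
    and "equivalent_objects TYPE('u) C \<kappa> X Y"
  shows "isomorphic C X Y"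
proof -
  have inf: "Cinfinite \<kappa>"
    using assms(1) by (simp add: regular_cardinal_def)
  have cat: "category C"
    using assms(2) by (simp add: mono_generated_def)
  obtain S where "dense_spans TYPE('u) C \<kappa> X Y S"
    using assms(5) by (auto simp: equivalent_objects_def)
  then obtain m where m: "m \<in> hom C X Y" "monic C m"
    and factor: "\<And>G g. generated TYPE('u) C \<kappa> G \<Longrightarrow> monic C g \<Longrightarrow> g \<in> hom C G Y \<Longrightarrow>
      \<exists>t \<in> hom C G X. m \<cdot>\<^bsub>C\<^esub> t = g"
    using monos_factor_through_generated_object[OF cat assms(3)] by blast
  obtain r :: "'u rel" and D c where diag: "directed_mono_diagram C \<kappa> r D"
    and gen: "\<forall>i \<in> Field r. generated TYPE('u) C \<kappa> (onObj D i)"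
    and colim: "colimit (poset_category r) C D Y c"
    using assms(2,4) unfolding mono_generated_def by blast
  show ?thesis
  proof (rule monic_iso_if_colimit_factors[OF cat colim m(2,1)])
    fix i assume "i \<in> Obj (poset_category r)"
    then show "\<exists>t \<in> hom C (onObj D i) X. m \<cdot>\<^bsub>C\<^esub> t = c i"
      using factor gen colimit_injection_monic[OF assms(2) inf diag colim]
        colimit_injection_hom[OF colim] by simp
  qed
qed

end
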